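(* Let $\Omega\subset\mathbb{R}^d$ ($d=2$ or $3$) be a bounded, sufficiently regular domain (or a periodic box), let $\mu,\tau,\nu>0$ be constants, and let $(v,q,k)$, with $v=v(x,t)$, $q=q(x,t)$, $k=k(x,t)$, be a sufficiently smooth solution of the 1-equation model with kinematic length scale $l=\sqrt{2k}\,\tau$, i.e. with $\nu_T(x,t)=\sqrt2\,\mu\,k(x,t)\,\tau$, $$v_t+v\cdot\nabla v-\nabla\cdot\big([2\nu+\nu_T]\nabla^s v\big)+\nabla q=f(x,t),\qquad \nabla\cdot v=0,$$ $$k_t+v\cdot\nabla k-\nabla\cdot(\nu_T\nabla k)+\frac{\sqrt2}{2}\tau^{-1}k=\nu_T|\nabla^s v|^2 .$$ Assume one of the following three boundary conditions holds: (i) internal flow: $v=0$ and $k=0$ on $\partial\Omega$; (ii) shear flow: $v\cdot n=0$ and $k=0$ on $\partial\Omega$, where $n$ is the unit outward normal; (iii) $\Omega$ is a periodic box and $v,q,k$ are periodic. Then the space averages $$k(t):=\frac1{|\Omega|}\int_\Omega k(x,t)\,dx,\qquad \varepsilon(t):=\frac1{|\Omega|}\int_\Omega \nu_T(x,t)\,|\nabla^s v(x,t)|^2\,dx$$ satisfy exactly $$\frac{d}{dt}k(t)+\frac{\sqrt2}{2}\tau^{-1}k(t)=\varepsilon(t).$$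
   Context: $\nabla^s v=\tfrac12(\nabla v+\nabla v^{T})$ is the symmetric part of the velocity gradient and $|\cdot|$ is the Euclidean (Frobenius) norm. The solution is assumed smooth enough (e.g. classical up to the boundary) for differentiation under the integral and the divergence theorem to be applicable. *)

theory Defs
  imports "HOL-Analysis.Analysis"
begin

section \<open>Spatial differential operators\<close>

definition partial_deriv ::
    "'d::finite \<Rightarrow> (real^'d \<Rightarrow> 'b::real_normed_vector) \<Rightarrow> real^'d \<Rightarrow> 'b" where
  "partial_deriv i g x = frechet_derivative g (at x) (axis i 1)"

definition grad :: "(real^'d::finite \<Rightarrow> real) \<Rightarrow> real^'d \<Rightarrow> real^'d" where
  "grad g x = (\<chi> i. partial_deriv i g x)"

definition divergence :: "(real^'d::finite \<Rightarrow> real^'d) \<Rightarrow> real^'d \<Rightarrow> real" where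
  "divergence F x = (\<Sum>i\<in>UNIV. partial_deriv i (\<lambda>y. F y $ i) x)"

definition matrix_divergence ::
    "(real^'d::finite \<Rightarrow> real^'d^'d) \<Rightarrow> real^'d \<Rightarrow> real^'d" where
  "matrix_divergence A x = (\<chi> i. divergence (\<lambda>y. A y $ i) x)"

text \<open>The norm of the type \<open>real^'d^'d\<close> is the Frobenius norm, so
  \<open>norm (sym_grad u x)\<close> below is the quantity written \<open>|\<nabla>\<^sup>s u|\<close>.\<close>

definition sym_grad :: "(real^'d::finite \<Rightarrow> real^'d) \<Rightarrow> real^'d \<Rightarrow> real^'d^'d" where
  "sym_grad u x =
     (\<chi> i j. (partial_deriv i (\<lambda>y. u y $ j) x + partial_deriv j (\<lambda>y. u y $ i) x) / 2)"

definition convection ::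
    "(real^'d::finite \<Rightarrow> real^'d) \<Rightarrow> (real^'d \<Rightarrow> 'b::real_normed_vector) \<Rightarrow> real^'d \<Rightarrow> 'b" where
  "convection u g x = (\<Sum>j\<in>UNIV. u x $ j *\<^sub>R partial_deriv j g x)"

definition time_deriv ::
    "(real \<Rightarrow> real^'d::finite \<Rightarrow> 'b::real_normed_vector) \<Rightarrow> real \<Rightarrow> real^'d \<Rightarrow> 'b" where
  "time_deriv g t x = vector_derivative (\<lambda>s. g s x) (at t)"

definition space_average :: "(real^'d::finite) set \<Rightarrow> (real^'d \<Rightarrow> real) \<Rightarrow> real" where
  "space_average \<Omega> g = (LINT x:\<Omega>|lborel. g x) / measure lborel \<Omega>"

section \<open>Smoothness up to the boundary\<close>

text \<open>Derivatives are only formed at points of the open set \<open>D\<close>; regularity up to the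
  boundary means that they have continuous extensions to \<open>I \<times> closure D\<close>.
  Functions of time and space take the time first.\<close>

definition continuous_up_to_boundary ::
    "real set \<Rightarrow> (real^'d::finite) set \<Rightarrow> (real \<Rightarrow> real^'d \<Rightarrow> 'b::real_normed_vector) \<Rightarrow> bool" where
  "continuous_up_to_boundary I D g \<longleftrightarrow>
     (\<exists>G. continuous_on (I \<times> closure D) G \<and> (\<forall>t\<in>I. \<forall>x\<in>D. G (t, x) = g t x))"

text \<open>Continuous in time, \<open>C\<^sup>1\<close> in space.\<close>

definition C1_space ::
    "real set \<Rightarrow> (real^'d::finite) set \<Rightarrow> (real \<Rightarrow> real^'d \<Rightarrow> 'b::real_normed_vector) \<Rightarrow> bool" where
  "C1_space I D g \<longleftrightarrow>
     continuous_on (I \<times> closure D) (\<lambda>(t, x). g t x) \<and>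
     (\<forall>t\<in>I. \<forall>x\<in>D. g t differentiable (at x)) \<and>
     (\<forall>i. continuous_up_to_boundary I D (\<lambda>t. partial_deriv i (g t)))"

text \<open>\<open>C\<^sup>1\<close> in time, \<open>C\<^sup>2\<close> in space.\<close>

definition C1_time_C2_space ::
    "real set \<Rightarrow> (real^'d::finite) set \<Rightarrow> (real \<Rightarrow> real^'d \<Rightarrow> 'b::real_normed_vector) \<Rightarrow> bool" where
  "C1_time_C2_space I D g \<longleftrightarrow>
     C1_space I D g \<and>
     (\<forall>i. \<forall>t\<in>I. \<forall>x\<in>D. partial_deriv i (g t) differentiable (at x)) \<and>
     (\<forall>i j. continuous_up_to_boundary I D (\<lambda>t. partial_deriv j (partial_deriv i (g t)))) \<and>
     (\<forall>t\<in>I. \<forall>x\<in>D. (\<lambda>s. g s x) differentiable (at t)) \<and>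
     continuous_up_to_boundary I D (time_deriv g)"

section \<open>Domains and their outward normals\<close>

text \<open>Near \<open>p\<close> the set \<open>\<Omega>\<close> is the region below the graph of a Lipschitz function, in
  coordinates whose vertical axis is the unit vector \<open>e\<close>; the argument of \<open>\<phi>\<close> is the
  orthogonal projection onto the hyperplane normal to \<open>e\<close>.\<close>

definition lipschitz_graph_near ::
    "(real^'d::finite) set \<Rightarrow> real^'d \<Rightarrow> real^'d \<Rightarrow> (real^'d \<Rightarrow> real) \<Rightarrow> bool" where
  "lipschitz_graph_near \<Omega> p e \<phi> \<longleftrightarrow>
     norm e = 1 \<and> (\<exists>L. L-lipschitz_on UNIV \<phi>) \<and>
     (\<exists>r>0. \<Omega> \<inter> ball p r = {x \<in> ball p r. x \<bullet> e < \<phi> (x - (x \<bullet> e) *\<^sub>R e)})"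

definition bounded_lipschitz_domain :: "(real^'d::finite) set \<Rightarrow> bool" where
  "bounded_lipschitz_domain \<Omega> \<longleftrightarrow>
     open \<Omega> \<and> connected \<Omega> \<and> \<Omega> \<noteq> {} \<and> bounded \<Omega> \<and>
     (\<forall>p\<in>frontier \<Omega>. \<exists>e \<phi>. lipschitz_graph_near \<Omega> p e \<phi>)"

text \<open>The normalised gradient of the local defining function \<open>x \<bullet> e - \<phi> (\<dots>)\<close>, at the
  boundary points where that function is differentiable: almost every boundary point of a
  Lipschitz domain, and every boundary point of a \<open>C\<^sup>1\<close> domain.\<close>

definition unit_outward_normal ::
    "(real^'d::finite) set \<Rightarrow> real^'d \<Rightarrow> real^'d \<Rightarrow> bool" where
  "unit_outward_normal \<Omega> p n \<longleftrightarrow>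
     p \<in> frontier \<Omega> \<and>
     (\<exists>e \<phi> g. lipschitz_graph_near \<Omega> p e \<phi> \<and>
        ((\<lambda>x. x \<bullet> e - \<phi> (x - (x \<bullet> e) *\<^sub>R e)) has_derivative (\<lambda>h. g \<bullet> h)) (at p) \<and>
        n = g /\<^sub>R norm g)"

definition box_periodic ::
    "real^'d::finite \<Rightarrow> real^'d \<Rightarrow> (real^'d \<Rightarrow> 'b) \<Rightarrow> bool" where
  "box_periodic a b g \<longleftrightarrow> (\<forall>i x. g (x + axis i (b $ i - a $ i)) = g x)"

section \<open>The 1-equation model\<close>

text \<open>\<open>\<nu>\<^sub>T = \<mu> \<surd>k l\<close> with the kinematic length scale \<open>l = \<surd>(2k) \<tau>\<close>.\<close>

definition eddy_viscosity ::
    "real \<Rightarrow> real \<Rightarrow> (real \<Rightarrow> real^'d::finite \<Rightarrow> real) \<Rightarrow> real \<Rightarrow> real^'d \<Rightarrow> real" where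
  "eddy_viscosity \<mu> \<tau> k t x = sqrt 2 * \<mu> * k t x * \<tau>"

definition one_equation_model_solution ::
    "real \<Rightarrow> real \<Rightarrow> real \<Rightarrow> real set \<Rightarrow> (real^'d::finite) set \<Rightarrow>
     (real \<Rightarrow> real^'d \<Rightarrow> real^'d) \<Rightarrow> (real \<Rightarrow> real^'d \<Rightarrow> real^'d) \<Rightarrow>
     (real \<Rightarrow> real^'d \<Rightarrow> real) \<Rightarrow> (real \<Rightarrow> real^'d \<Rightarrow> real) \<Rightarrow> bool" where
  "one_equation_model_solution \<mu> \<tau> \<nu> I D f v q k \<longleftrightarrow>
     C1_time_C2_space I D v \<and> C1_space I D q \<and> C1_time_C2_space I D k \<and>
     (\<forall>t\<in>I. \<forall>x\<in>D.
        time_deriv v t x + convection (v t) (v t) x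
          - matrix_divergence
              (\<lambda>y. (2 * \<nu> + eddy_viscosity \<mu> \<tau> k t y) *\<^sub>R sym_grad (v t) y) x
          + grad (q t) x = f t x \<and>
        divergence (v t) x = 0 \<and>
        time_deriv k t x + convection (v t) (k t) x
          - divergence (\<lambda>y. eddy_viscosity \<mu> \<tau> k t y *\<^sub>R grad (k t) y) x
          + sqrt 2 / 2 * inverse \<tau> * k t x
          = eddy_viscosity \<mu> \<tau> k t x * (norm (sym_grad (v t) x))\<^sup>2)"

definition internal_flow ::
    "real \<Rightarrow> real \<Rightarrow> real \<Rightarrow> real set \<Rightarrow> (real^'d::finite) set \<Rightarrow>
     (real \<Rightarrow> real^'d \<Rightarrow> real^'d) \<Rightarrow> (real \<Rightarrow> real^'d \<Rightarrow> real^'d) \<Rightarrow>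
     (real \<Rightarrow> real^'d \<Rightarrow> real) \<Rightarrow> (real \<Rightarrow> real^'d \<Rightarrow> real) \<Rightarrow> bool" where
  "internal_flow \<mu> \<tau> \<nu> I \<Omega> f v q k \<longleftrightarrow>
     bounded_lipschitz_domain \<Omega> \<and> one_equation_model_solution \<mu> \<tau> \<nu> I \<Omega> f v q k \<and>
     (\<forall>t\<in>I. \<forall>p\<in>frontier \<Omega>. v t p = 0 \<and> k t p = 0)"

definition shear_flow ::
    "real \<Rightarrow> real \<Rightarrow> real \<Rightarrow> real set \<Rightarrow> (real^'d::finite) set \<Rightarrow>
     (real \<Rightarrow> real^'d \<Rightarrow> real^'d) \<Rightarrow> (real \<Rightarrow> real^'d \<Rightarrow> real^'d) \<Rightarrow>
     (real \<Rightarrow> real^'d \<Rightarrow> real) \<Rightarrow> (real \<Rightarrow> real^'d \<Rightarrow> real) \<Rightarrow> bool" where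
  "shear_flow \<mu> \<tau> \<nu> I \<Omega> f v q k \<longleftrightarrow>
     bounded_lipschitz_domain \<Omega> \<and> one_equation_model_solution \<mu> \<tau> \<nu> I \<Omega> f v q k \<and>
     (\<forall>t\<in>I. \<forall>p\<in>frontier \<Omega>.
        (\<forall>n. unit_outward_normal \<Omega> p n \<longrightarrow> v t p \<bullet> n = 0) \<and> k t p = 0)"

text \<open>The periodic box stands for the torus: the fields are periodic on the whole space and
  solve the system there, so that they are smooth across the faces of the box.\<close>

definition periodic_flow ::
    "real \<Rightarrow> real \<Rightarrow> real \<Rightarrow> real set \<Rightarrow> (real^'d::finite) set \<Rightarrow>
     (real \<Rightarrow> real^'d \<Rightarrow> real^'d) \<Rightarrow> (real \<Rightarrow> real^'d \<Rightarrow> real^'d) \<Rightarrow>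
     (real \<Rightarrow> real^'d \<Rightarrow> real) \<Rightarrow> (real \<Rightarrow> real^'d \<Rightarrow> real) \<Rightarrow> bool" where
  "periodic_flow \<mu> \<tau> \<nu> I \<Omega> f v q k \<longleftrightarrow>
     (\<exists>a b. (\<forall>i. a $ i < b $ i) \<and> \<Omega> = box a b \<and>
        (\<forall>t\<in>I. box_periodic a b (v t) \<and> box_periodic a b (q t) \<and> box_periodic a b (k t))) \<and>
     one_equation_model_solution \<mu> \<tau> \<nu> I UNIV f v q k"

definition mean_k :: "(real^'d::finite) set \<Rightarrow> (real \<Rightarrow> real^'d \<Rightarrow> real) \<Rightarrow> real \<Rightarrow> real" where
  "mean_k \<Omega> k t = space_average \<Omega> (k t)"

definition mean_dissipation ::
    "real \<Rightarrow> real \<Rightarrow> (real^'d::finite) set \<Rightarrow> (real \<Rightarrow> real^'d \<Rightarrow> real^'d) \<Rightarrow>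
     (real \<Rightarrow> real^'d \<Rightarrow> real) \<Rightarrow> real \<Rightarrow> real" where
  "mean_dissipation \<mu> \<tau> \<Omega> v k t =
     space_average \<Omega> (\<lambda>x. eddy_viscosity \<mu> \<tau> k t x * (norm (sym_grad (v t) x))\<^sup>2)"

end

theory Submission
  imports Defs
begin

text \<open>Since \<open>div v = 0\<close>, the \<open>k\<close>-equation reads
  \<open>k\<^sub>t + div (k v - \<nu>\<^sub>T \<nabla>k) + (\<surd>2 / 2) \<tau>\<^sup>-\<^sup>1 k = \<nu>\<^sub>T |\<nabla>\<^sup>s v|\<^sup>2\<close>, so it suffices that the divergence
  of the flux has integral zero. As \<open>\<nu>\<^sub>T\<close> is a multiple of \<open>k\<close>, the whole flux vanishes where
  \<open>k = 0\<close>, whatever the boundary values of \<open>v\<close>. For such a flux the divergence theorem is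
  one-dimensional: every line parallel to a coordinate axis meets \<open>\<Omega>\<close> in countably many open
  intervals, and on each of them the integral of the derivative is the difference of two boundary
  values of the flux, both zero (or equal, in a periodic box).\<close>

section \<open>Integrals of partial derivatives\<close>

lemma bounded_continuous_set_integrable:
  fixes g :: "'a::euclidean_space \<Rightarrow> real"
  assumes "open D" "bounded D" "continuous_on D g" "bounded (g ` D)"
  shows "set_integrable lborel D g"
proof -
  obtain B where "\<And>x. x \<in> D \<Longrightarrow> norm (g x) \<le> B"
    using assms(4) by (auto simp: bounded_iff)
  moreover have "set_borel_measurable lborel D g"
    unfolding set_borel_measurable_def measurable_lborel1
    using borel_measurable_continuous_on_indicator[of D g] assms by simp
  moreover have "set_integrable lborel D (\<lambda>_. B)"
    unfolding set_integrable_def real_scaleR_def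
    using assms emeasure_bounded_finite[of D] by simp
  ultimately show ?thesis
    using assms by (intro set_integrable_bound[of lborel D "\<lambda>_. B" g])
      (auto intro!: AE_I2 order_trans[OF _ abs_ge_self])
qed

section \<open>Integrals over open subsets of the real line\<close>

lemma open_bounded_connected_real:
  fixes C :: "real set"
  assumes "open C" "connected C" "bounded C" "C \<noteq> {}"
  obtains a b where "a < b" "C = {a<..<b}"
proof -
  define a where "a = Inf C"
  define b where "b = Sup C"
  have bdd: "bdd_below C" "bdd_above C"
    using assms(3) by (rule bounded_imp_bdd_below, rule bounded_imp_bdd_above)
  have "C \<subseteq> {a<..<b}"
  proof
    fix x assume x: "x \<in> C"
    then obtain e where e: "e > 0" "cball x e \<subseteq> C"
      using assms(1) open_contains_cball by blast
    then have "x - e \<in> C" "x + e \<in> C"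
      by (auto simp: subset_eq dist_real_def)
    then have "a \<le> x - e" "x + e \<le> b"
      unfolding a_def b_def using bdd by (auto intro: cInf_lower cSup_upper)
    then show "x \<in> {a<..<b}"
      using e by auto
  qed
  moreover have "{a<..<b} \<subseteq> C"
  proof
    fix x assume "x \<in> {a<..<b}"
    then obtain y z where "y \<in> C" "y < x" "z \<in> C" "x < z"
      unfolding a_def b_def using assms(4) bdd
      by (metis cInf_less_iff greaterThanLessThan_iff less_cSup_iff)
    then show "x \<in> C"
      using assms(2) connectedD_interval[of C y z x] by auto
  qed
  ultimately have "C = {a<..<b}" by auto
  moreover from this assms(4) have "a < b" by auto
  ultimately show ?thesis using that by blast
qed

text \<open>The components of \<open>U\<close> are countably many bounded open intervals whose end
  points lie outside \<open>U\<close>, so \<open>ends\<close> applies to each of them. The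
  fundamental theorem makes the integral over each component zero, and countable additivity, for
  which \<open>int\<close> is required, makes the total zero.\<close>

lemma integral_deriv_open_bounded_eq_0:
  fixes h h' :: "real \<Rightarrow> real"
  assumes "open U" "bounded U" "continuous_on (closure U) h"
    and deriv: "\<And>s. s \<in> U \<Longrightarrow> (h has_real_derivative h' s) (at s)"
    and int: "set_integrable lborel U h'"
    and ends: "\<And>a b. a < b \<Longrightarrow> {a<..<b} \<subseteq> U \<Longrightarrow> a \<notin> U \<Longrightarrow> b \<notin> U \<Longrightarrow> h a = h b"
  shows "(LINT s:U|lborel. h' s) = 0"
proof -
  have open_C: "open C" if "C \<in> components U" for C
    using that assms(1) open_components by blast
  have comp: "(LINT s:C|lborel. h' s) = 0" if C: "C \<in> components U" for C
  proof -
    have sub: "C \<subseteq> U" using C in_components_subset by blast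
    obtain a b where ab: "a < b" "C = {a<..<b}"
      using open_bounded_connected_real[of C] C open_C sub assms(2) bounded_subset
        in_components_connected in_components_nonempty by metis
    have 1: "{a..b} \<subseteq> closure U"
      using closure_mono[OF sub] ab by simp
    \<comment> \<open>An end point lying in \<open>U\<close> could be added to the interval without
      losing connectedness, against the maximality of the component.\<close>
    have ends_notin: "y \<notin> U" if "y = a \<or> y = b" for y
    proof
      assume "y \<in> U"
      have "connected (insert y C)"
        by (rule connected_intermediate_closure[of C]) (use that ab in auto)
      then have "insert y C \<subseteq> C"
        using components_maximal[OF C, of "insert y C"] \<open>y \<in> U\<close> sub that ab by auto
      then show False using that ab by auto
    qed
    then have "a \<notin> U" "b \<notin> U" by blast+
    then have "h a = h b" using ends ab sub by blast
    \<comment> \<open>This form of the fundamental theorem asks for the derivative only inside the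
      interval and for continuity up to its end points, just what \<open>U\<close> and
      \<open>closure U\<close> supply.\<close>
    moreover have "(h' has_integral (h b - h a)) {a..b}"
    proof (rule fundamental_theorem_of_calculus_interior)
      show "continuous_on {a..b} h"
        using 1 assms(3) continuous_on_subset by blast
      show "(h has_vector_derivative h' s) (at s)" if "s \<in> {a<..<b}" for s
        using that sub ab deriv[of s]
        by (auto simp: has_real_derivative_iff_has_vector_derivative)
    qed (use ab in simp)
    ultimately have "(h' has_integral 0) C"
      using ab by (simp add: has_integral_Icc_iff_Ioo)
    moreover have "set_integrable lborel C h'"
      using int sub open_C[OF C] set_integrable_subset[of lborel U h' C] by simp
    ultimately show ?thesis
      using set_borel_integral_eq_integral(2) integral_unique by metis
  qed
  have cnt: "countable (components U)"
    using countable_disjoint_open_subsets[of "components U"] open_C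
      pairwise_disjoint_components[of U] by (auto simp: pairwise_def disjnt_def)
  \<comment> \<open>Numbering the components puts their union in the form required by countable
    additivity. A number borne by no component yields the empty set, whose integral is 0.\<close>
  define A where "A n = \<Union>{C \<in> components U. to_nat_on (components U) C = n}" for n
  have inj: "inj_on (to_nat_on (components U)) (components U)"
    using cnt by (rule inj_on_to_nat_on)
  have A: "A n = {} \<or> A n \<in> components U" for n
  proof (cases "\<exists>C\<in>components U. to_nat_on (components U) C = n")
    case True
    then obtain C where "C \<in> components U" "to_nat_on (components U) C = n" by blast
    then have "{C \<in> components U. to_nat_on (components U) C = n} = {C}"
      using inj by (auto dest: inj_onD)
    then show ?thesis using \<open>C \<in> components U\<close> by (simp add: A_def)
  qed (auto simp: A_def)
  have U: "(\<Union>n. A n) = U"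
  proof -
    have "(\<Union>n. A n) = \<Union>(components U)"
      unfolding A_def by blast
    then show ?thesis using Union_components by metis
  qed
  have disj: "A i \<inter> A j = {}" if "i \<noteq> j" for i j
  proof (rule ccontr)
    assume "A i \<inter> A j \<noteq> {}"
    then obtain x C C' where "x \<in> C" "x \<in> C'" "C \<in> components U" "C' \<in> components U"
      "to_nat_on (components U) C = i" "to_nat_on (components U) C' = j"
      unfolding A_def by blast
    then show False using that components_nonoverlap by blast
  qed
  have "(LINT s:(\<Union>n. A n)|lborel. h' s) = (\<Sum>n. LINT s:A n|lborel. h' s)"
  proof (rule lebesgue_integral_countable_add)
    show "A n \<in> sets lborel" for n
      using A[of n] open_C by auto
    show "A i \<inter> A j = {}" if "i \<noteq> j" for i j
      using that by (rule disj)
    show "set_integrable lborel (\<Union>n. A n) h'"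
      unfolding U by (rule int)
  qed
  also have "\<dots> = 0"
  proof -
    have "(LINT s:A n|lborel. h' s) = 0" for n
      using A[of n] comp by (auto simp: set_lebesgue_integral_def)
    then show ?thesis by simp
  qed
  finally show ?thesis unfolding U .
qed

section \<open>From line integrals to integrals over space\<close>

lemma integrable_of_bounded_support:
  fixes H :: "'a::euclidean_space \<Rightarrow> real"
  assumes "H \<in> borel_measurable borel" "\<And>x. \<bar>H x\<bar> \<le> B"
    and "bounded S" "\<And>x. x \<notin> S \<Longrightarrow> H x = 0"
  shows "integrable lborel H"
proof -
  obtain R where R: "S \<subseteq> cball 0 R"
    using bounded_subset_ballD[OF assms(3), of 0] ball_subset_cball by blast
  have "integrable lborel (\<lambda>x. B * indicator (cball 0 R) x :: real)"
    by (intro integrable_mult_right integrable_real_indicator emeasure_bounded_finite) auto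
  then show ?thesis
  proof (rule Bochner_Integration.integrable_bound)
    show "AE x in lborel. norm (H x) \<le> norm (B * indicator (cball 0 R) x)"
    proof (rule AE_I2)
      fix x
      have "\<bar>H x\<bar> \<le> \<bar>B\<bar>" by (rule order_trans[OF assms(2) abs_ge_self])
      then show "norm (H x) \<le> norm (B * indicator (cball 0 R) x)"
        using assms(4)[of x] subsetD[OF R, of x] by (cases "x \<in> cball 0 R") auto
    qed
  qed (use assms in simp)
qed

text \<open>Weighting with \<open>w x = 1\<close> for \<open>x $ i \<in> {0..1}\<close> makes \<open>w x * G (x + s e\<^sub>i)\<close> integrable in
  \<open>(x, s)\<close>; integrating first over \<open>s\<close> gives the line integrals, first over \<open>x\<close> (after a
  translation) gives the integral of \<open>G\<close>.\<close>

lemma integral_eq_0_if_line_integrals_eq_0: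
  fixes G :: "real^'d::finite \<Rightarrow> real"
  assumes [measurable]: "G \<in> borel_measurable borel" and B: "\<And>x. \<bar>G x\<bar> \<le> B"
    and S: "bounded S" "\<And>x. x \<notin> S \<Longrightarrow> G x = 0"
    and lines: "\<And>x. (LINT s|lborel. G (x + s *\<^sub>R axis i 1)) = 0"
  shows "(LINT x|lborel. G x) = 0"
proof -
  define e :: "real^'d" where "e = axis i 1"
  define w :: "real^'d \<Rightarrow> real" where "w x = indicator {0..1} (x $ i)" for x
  have [measurable]: "w \<in> borel_measurable borel" unfolding w_def by measurable
  obtain R where R: "\<And>x. G x \<noteq> 0 \<Longrightarrow> norm x \<le> R"
    using S by (metis bounded_iff)
  have w1: "\<bar>w x * G y\<bar> \<le> B" for x y
    using B[of y] by (auto simp: w_def indicator_def)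
  \<comment> \<open>Here \<open>x $ i\<close> lies in \<open>{0..1}\<close> and
    \<open>x + s *\<^sub>R e\<close> has norm at most \<open>R\<close>. Its coordinate
    \<open>i\<close> gives \<open>\<bar>s\<bar> \<le> R + 1\<close>, and the triangle inequality
    then gives \<open>norm x \<le> R + (R + 1)\<close>.\<close>
  have supp1: "x \<in> cball 0 (2 * R + 1)" "s \<in> cball 0 (R + 1)"
    if "w x * G (x + s *\<^sub>R e) \<noteq> 0" for x s
  proof -
    have x: "x $ i \<in> {0..1}" and n: "norm (x + s *\<^sub>R e) \<le> R"
      using that R by (auto simp: w_def indicator_def split: if_splits)
    have "\<bar>(x + s *\<^sub>R e) $ i\<bar> \<le> R"
      using n component_le_norm_cart order_trans by blast
    then have s: "\<bar>s\<bar> \<le> R + 1"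
      using x by (auto simp: e_def axis_def)
    have "norm x \<le> norm (x + s *\<^sub>R e) + norm (s *\<^sub>R e)"
      using norm_triangle_ineq4[of "x + s *\<^sub>R e" "s *\<^sub>R e"] by simp
    then have "norm x \<le> 2 * R + 1" using n s by (simp add: e_def)
    then show "x \<in> cball 0 (2 * R + 1)" "s \<in> cball 0 (R + 1)" using s by auto
  qed
  have supp2: "y \<in> cball 0 R" "s \<in> cball 0 (R + 1)"
    if "w (y - s *\<^sub>R e) * G y \<noteq> 0" for y s
  proof -
    have x: "(y - s *\<^sub>R e) $ i \<in> {0..1}" and n: "norm y \<le> R"
      using that R by (auto simp: w_def indicator_def split: if_splits)
    moreover have "\<bar>y $ i\<bar> \<le> R"
      using n component_le_norm_cart order_trans by blast
    ultimately show "y \<in> cball 0 R" "s \<in> cball 0 (R + 1)"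
      by (auto simp: e_def axis_def)
  qed
  have int1: "integrable (lborel \<Otimes>\<^sub>M lborel) (\<lambda>(x, s). w x * G (x + s *\<^sub>R e))"
    unfolding lborel_prod
  proof (rule integrable_of_bounded_support)
    have "(\<lambda>(x, s). w x * G (x + s *\<^sub>R e)) \<in> borel_measurable (borel \<Otimes>\<^sub>M borel)"
      by measurable
    then show "(\<lambda>(x, s). w x * G (x + s *\<^sub>R e)) \<in> borel_measurable borel"
      by (simp add: borel_prod)
    show "\<bar>case p of (x, s) \<Rightarrow> w x * G (x + s *\<^sub>R e)\<bar> \<le> B" for p
      using w1 by (cases p) simp
    show "bounded (cball 0 (2 * R + 1) \<times> cball 0 (R + 1) :: ((real^'d) \<times> real) set)"
      by (intro bounded_Times bounded_cball)
    show "(case p of (x, s) \<Rightarrow> w x * G (x + s *\<^sub>R e)) = 0"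
      if "p \<notin> cball 0 (2 * R + 1) \<times> cball 0 (R + 1)" for p
      using that supp1[of "fst p" "snd p"] unfolding case_prod_beta by (auto simp: mem_Times_iff)
  qed
  have int2: "integrable (lborel \<Otimes>\<^sub>M lborel) (\<lambda>(y, s). w (y - s *\<^sub>R e) * G y)"
    unfolding lborel_prod
  proof (rule integrable_of_bounded_support)
    have "(\<lambda>(y, s). w (y - s *\<^sub>R e) * G y) \<in> borel_measurable (borel \<Otimes>\<^sub>M borel)"
      by measurable
    then show "(\<lambda>(y, s). w (y - s *\<^sub>R e) * G y) \<in> borel_measurable borel"
      by (simp add: borel_prod)
    show "\<bar>case p of (y, s) \<Rightarrow> w (y - s *\<^sub>R e) * G y\<bar> \<le> B" for p
      using w1 by (cases p) simp
    show "bounded (cball 0 R \<times> cball 0 (R + 1) :: ((real^'d) \<times> real) set)"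
      by (intro bounded_Times bounded_cball)
    show "(case p of (y, s) \<Rightarrow> w (y - s *\<^sub>R e) * G y) = 0"
      if "p \<notin> cball 0 R \<times> cball 0 (R + 1)" for p
      using that supp2[of "fst p" "snd p"] unfolding case_prod_beta by (auto simp: mem_Times_iff)
  qed
  \<comment> \<open>Translation invariance of Lebesgue measure, with
    \<open>y = x + s *\<^sub>R e\<close>.\<close>
  have trans: "(LINT x|lborel. w x * G (x + s *\<^sub>R e)) = (LINT y|lborel. w (y - s *\<^sub>R e) * G y)" for s
  proof -
    have "(LINT y|lborel. w (y - s *\<^sub>R e) * G y)
        = (LINT y|distr lborel borel ((+) (s *\<^sub>R e)). w (y - s *\<^sub>R e) * G y)"
      by (simp only: lborel_distr_plus)
    also have "\<dots> = (LINT x|lborel. w x * G (x + s *\<^sub>R e))"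
      by (subst integral_distr) (simp_all add: add.commute)
    finally show ?thesis by simp
  qed
  \<comment> \<open>As a function of \<open>s\<close> the translated weight is the indicator of an
    interval of length 1, so \<open>w\<close> drops out after integration over
    \<open>s\<close>.\<close>
  have weight: "(LINT s|lborel. w (y - s *\<^sub>R e)) = 1" for y
  proof -
    have "w (y - s *\<^sub>R e) = indicator {y $ i - 1..y $ i} s" for s
      by (auto simp: w_def indicator_def e_def axis_def)
    then show ?thesis by simp
  qed
  have "0 = (LINT x|lborel. LINT s|lborel. w x * G (x + s *\<^sub>R e))"
    using lines by (simp add: e_def)
  also have "\<dots> = (LINT s|lborel. LINT x|lborel. w x * G (x + s *\<^sub>R e))"
    using lborel_pair.Fubini_integral[OF int1] by simp
  also have "\<dots> = (LINT s|lborel. LINT y|lborel. w (y - s *\<^sub>R e) * G y)"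
    by (simp only: trans)
  also have "\<dots> = (LINT y|lborel. LINT s|lborel. w (y - s *\<^sub>R e) * G y)"
    using lborel_pair.Fubini_integral[OF int2] by simp
  also have "\<dots> = (LINT y|lborel. G y)"
    by (simp add: weight)
  finally show ?thesis by simp
qed

lemma has_real_derivative_along_axis:
  fixes F :: "real^'d::finite \<Rightarrow> real"
  assumes "F differentiable (at (x + s *\<^sub>R axis i 1))"
  shows "((\<lambda>s. F (x + s *\<^sub>R axis i 1)) has_real_derivative
           partial_deriv i F (x + s *\<^sub>R axis i 1)) (at s)"
proof -
  let ?y = "x + s *\<^sub>R axis i 1"
  have F: "(F has_derivative frechet_derivative F (at ?y)) (at ?y)"
    using assms frechet_derivative_works by blast
  have "((\<lambda>s. x + s *\<^sub>R axis i 1) has_derivative (\<lambda>h. h *\<^sub>R axis i 1)) (at s)"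
    by (auto intro!: derivative_eq_intros)
  from diff_chain_at[OF this F]
  have "((\<lambda>s. F (x + s *\<^sub>R axis i 1)) has_derivative
      (\<lambda>h. frechet_derivative F (at ?y) (h *\<^sub>R axis i 1))) (at s)"
    by (simp add: o_def)
  moreover have "frechet_derivative F (at ?y) (h *\<^sub>R axis i 1) = partial_deriv i F ?y * h" for h
    using has_derivative_bounded_linear[OF F]
    by (simp add: partial_deriv_def bounded_linear.linear linear_scale)
  ultimately show ?thesis
    by (simp add: has_field_derivative_def)
qed

text \<open>A divergence theorem in a single coordinate direction. Each line parallel to the axis
  cuts \<open>D\<close> in an open bounded set of parameters, to which the one-dimensional result
  applies; \<open>ends\<close> speaks of exactly the components of these slices. The zero extension
  of the derivative then has vanishing line integrals.\<close>

lemma integral_partial_deriv_eq_0: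
  fixes F :: "real^'d::finite \<Rightarrow> real"
  assumes "open D" "bounded D" "continuous_on (closure D) F"
    and diff: "\<And>x. x \<in> D \<Longrightarrow> F differentiable (at x)"
    and cont: "continuous_on D (partial_deriv i F)" and bdd: "bounded (partial_deriv i F ` D)"
    and ends: "\<And>x s. s > 0 \<Longrightarrow> x \<notin> D \<Longrightarrow> x + s *\<^sub>R axis i 1 \<notin> D \<Longrightarrow>
          (\<And>r. 0 < r \<Longrightarrow> r < s \<Longrightarrow> x + r *\<^sub>R axis i 1 \<in> D) \<Longrightarrow> F x = F (x + s *\<^sub>R axis i 1)"
  shows "(LINT x:D|lborel. partial_deriv i F x) = 0"
proof -
  obtain B where B: "\<And>x. x \<in> D \<Longrightarrow> \<bar>partial_deriv i F x\<bar> \<le> B"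
    using bdd by (auto simp: bounded_iff)
  show ?thesis
    unfolding set_lebesgue_integral_def
  proof (rule integral_eq_0_if_line_integrals_eq_0[where S = D and i = i])
    \<comment> \<open>\<open>B\<close> bounds the values on \<open>D\<close> only and may be
      negative when \<open>D\<close> is empty; the maximum with 0 covers the points outside
      \<open>D\<close>.\<close>
    show "\<bar>indicator D x *\<^sub>R partial_deriv i F x\<bar> \<le> max B 0" for x
      using B[of x] by (auto simp: indicator_def)
    show "(\<lambda>x. indicator D x *\<^sub>R partial_deriv i F x) \<in> borel_measurable borel"
      using assms(1) cont by (intro borel_measurable_continuous_on_indicator) auto
    fix x :: "real^'d"
    let ?l = "\<lambda>s. x + s *\<^sub>R axis i 1"
    define U where "U = ?l -` D"
    have l: "continuous_on A ?l" for A by (intro continuous_intros)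
    have openU: "open U" unfolding U_def using assms(1) l by (rule open_vimage)
    obtain R where R: "\<And>y. y \<in> D \<Longrightarrow> norm y \<le> R"
      using assms(2) by (auto simp: bounded_iff)
    have bddU: "bounded U"
    proof (rule boundedI)
      fix s assume "s \<in> U"
      have "\<bar>s\<bar> \<le> norm (?l s) + norm x"
        using norm_triangle_ineq4[of "?l s" x] by simp
      then show "norm s \<le> R + norm x" using R[of "?l s"] \<open>s \<in> U\<close> by (auto simp: U_def)
    qed
    have lcl: "?l ` closure U \<subseteq> closure D"
      by (rule image_closure_subset[OF l]) (use closure_subset in \<open>auto simp: U_def\<close>)
    have "(LINT s:U|lborel. partial_deriv i F (?l s)) = 0"
    proof (rule integral_deriv_open_bounded_eq_0[OF openU bddU, where h = "\<lambda>s. F (?l s)"])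
      show "continuous_on (closure U) (\<lambda>s. F (?l s))"
        using continuous_on_compose2[OF assms(3) l lcl] .
      show "((\<lambda>s. F (?l s)) has_real_derivative partial_deriv i F (?l s)) (at s)" if "s \<in> U" for s
        using that diff by (intro has_real_derivative_along_axis) (simp add: U_def)
      show "set_integrable lborel U (\<lambda>s. partial_deriv i F (?l s))"
      proof (rule bounded_continuous_set_integrable[OF openU bddU])
        show "continuous_on U (\<lambda>s. partial_deriv i F (?l s))"
          by (rule continuous_on_compose2[OF cont l]) (auto simp: U_def)
        show "bounded ((\<lambda>s. partial_deriv i F (?l s)) ` U)"
          by (rule bounded_subset[OF bdd]) (auto simp: U_def)
      qed
      fix a b assume ab: "a < b" "{a<..<b} \<subseteq> U" "a \<notin> U" "b \<notin> U"
      \<comment> \<open>Moving the base point to the left end of the interval brings the interval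
        into the form of \<open>ends\<close>, with length \<open>b - a\<close>.\<close>
      have eq: "?l a + r *\<^sub>R axis i 1 = ?l (a + r)" for r
        by (simp add: scaleR_left_distrib)
      have "F (?l a) = F (?l a + (b - a) *\<^sub>R axis i 1)"
      proof (rule ends)
        show "?l a + r *\<^sub>R axis i 1 \<in> D" if "0 < r" "r < b - a" for r
          unfolding eq using that subsetD[OF ab(2), of "a + r"] by (auto simp: U_def)
      qed (use ab in \<open>auto simp: U_def eq\<close>)
      then show "F (?l a) = F (?l b)" using eq[of "b - a"] by simp
    qed
    then show "(LINT s|lborel. indicator D (?l s) *\<^sub>R partial_deriv i F (?l s)) = 0"
      by (simp add: set_lebesgue_integral_def U_def indicator_vimage)
  qed (use assms in auto)
qed

section \<open>Regularity up to the boundary\<close>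

lemma continuous_up_to_boundary_continuous_on:
  assumes "continuous_up_to_boundary I D g" "t \<in> I"
  shows "continuous_on D (g t)"
proof -
  obtain G where G: "continuous_on (I \<times> closure D) G" "\<And>t x. t \<in> I \<Longrightarrow> x \<in> D \<Longrightarrow> G (t, x) = g t x"
    using assms(1) unfolding continuous_up_to_boundary_def by blast
  have "continuous_on D (\<lambda>x. G (t, x))"
    using assms(2) closure_subset
    by (intro continuous_on_compose2[OF G(1)] continuous_intros) auto
  then show ?thesis
    using G(2) assms(2) by (simp cong: continuous_on_cong)
qed

text \<open>The extension is continuous on the compact set \<open>J \<times> closure D\<close>.
  Uniformity in time provides the dominating constant for differentiation under the
  integral.\<close>

lemma continuous_up_to_boundary_bounded:
  assumes "continuous_up_to_boundary I D g" "bounded D" "compact J" "J \<subseteq> I"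
  shows "\<exists>B. \<forall>s\<in>J. \<forall>x\<in>D. norm (g s x) \<le> B"
proof -
  obtain G where G: "continuous_on (I \<times> closure D) G" "\<And>t x. t \<in> I \<Longrightarrow> x \<in> D \<Longrightarrow> G (t, x) = g t x"
    using assms(1) unfolding continuous_up_to_boundary_def by blast
  have "compact (J \<times> closure D)"
    using assms by (auto intro!: compact_Times)
  moreover have "continuous_on (J \<times> closure D) G"
    using G(1) assms(4) by (elim continuous_on_subset) auto
  ultimately have "bounded (G ` (J \<times> closure D))"
    using compact_continuous_image compact_imp_bounded by blast
  then obtain B where B: "\<And>p. p \<in> J \<times> closure D \<Longrightarrow> norm (G p) \<le> B"
    by (auto simp: bounded_iff)
  have "norm (g s x) \<le> B" if "s \<in> J" "x \<in> D" for s x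
    using B[of "(s, x)"] G(2)[of s x] that subsetD[OF assms(4)] subsetD[OF closure_subset] by fastforce
  then show ?thesis by blast
qed

lemma continuous_up_to_boundary_integrable:
  fixes g :: "real \<Rightarrow> real^'d::finite \<Rightarrow> real"
  assumes "continuous_up_to_boundary I D g" "open D" "bounded D" "t \<in> I"
  shows "set_integrable lborel D (g t)"
proof (rule bounded_continuous_set_integrable[OF assms(2,3)])
  show "continuous_on D (g t)"
    using assms continuous_up_to_boundary_continuous_on by blast
  show "bounded (g t ` D)"
    using continuous_up_to_boundary_bounded[OF assms(1,3), of "{t}"] assms(4)
    by (auto simp: bounded_iff)
qed

lemma continuous_on_imp_continuous_up_to_boundary:
  assumes "continuous_on (I \<times> closure D) (\<lambda>(t, x). g t x)"
  shows "continuous_up_to_boundary I D g"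
  unfolding continuous_up_to_boundary_def
  using assms by (intro exI[of _ "\<lambda>(t, x). g t x"]) auto

text \<open>Differentiation under the integral by dominated convergence: near \<open>t\<close> the
  time derivative is bounded uniformly in space, hence so are the difference quotients, and a
  constant is integrable over the bounded set \<open>D\<close>.\<close>

lemma has_real_derivative_set_integral:
  fixes g :: "real \<Rightarrow> real^'d::finite \<Rightarrow> real"
  assumes "open I" "t \<in> I" "open D" "bounded D"
    and g: "continuous_up_to_boundary I D g"
    and diff: "\<And>s x. s \<in> I \<Longrightarrow> x \<in> D \<Longrightarrow> (\<lambda>s. g s x) differentiable (at s)"
    and gt: "continuous_up_to_boundary I D (time_deriv g)"
  shows "((\<lambda>s. LINT x:D|lborel. g s x) has_real_derivative (LINT x:D|lborel. time_deriv g t x)) (at t)"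
proof -
  have deriv: "((\<lambda>s. g s x) has_real_derivative time_deriv g s x) (at s)"
    if "s \<in> I" "x \<in> D" for s x
    using diff[OF that]
    by (simp add: time_deriv_def vector_derivative_works has_real_derivative_iff_has_vector_derivative)
  \<comment> \<open>A closed ball, because compactness in time is what yields the bound
    \<open>B\<close>.\<close>
  obtain \<delta> where \<delta>: "\<delta> > 0" "cball t \<delta> \<subseteq> I"
    using assms(1,2) open_contains_cball by blast
  obtain B where B: "\<And>s x. s \<in> cball t \<delta> \<Longrightarrow> x \<in> D \<Longrightarrow> \<bar>time_deriv g s x\<bar> \<le> B"
    using continuous_up_to_boundary_bounded[OF gt assms(4) compact_cball \<delta>(2)]
    unfolding real_norm_def by blast
  \<comment> \<open>The mean value inequality in time, for fixed \<open>x\<close>.\<close>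
  have lip: "\<bar>(g s x - g t x) / (s - t)\<bar> \<le> B"
    if "s \<in> cball t \<delta>" "s \<noteq> t" "x \<in> D" for s x
  proof -
    have "norm (g s x - g t x) \<le> B * norm (s - t)"
    proof (rule field_differentiable_bound[where S = "cball t \<delta>"])
      show "((\<lambda>s. g s x) has_field_derivative time_deriv g r x) (at r within cball t \<delta>)"
        if "r \<in> cball t \<delta>" for r
        using that deriv[of r x] \<delta>(2) \<open>x \<in> D\<close> has_field_derivative_at_within by blast
    qed (use that \<delta> B in auto)
    then show ?thesis
      using that by (simp add: abs_divide pos_divide_le_eq)
  qed
  have int: "set_integrable lborel D (g s)" if "s \<in> I" for s
    using continuous_up_to_boundary_integrable g that assms by blast
  have intB: "integrable lborel (\<lambda>x. B * indicator D x :: real)"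
    using assms(3,4) emeasure_bounded_finite[of D] by simp
  \<comment> \<open>Dominated convergence concerns sequences, so the limit of the difference
    quotients is tested along sequences in the punctured ball.\<close>
  have "(\<lambda>n. ((LINT x:D|lborel. g (X n) x) - (LINT x:D|lborel. g t x)) / (X n - t))
      \<longlonglongrightarrow> (LINT x:D|lborel. time_deriv g t x)"
    if X: "\<forall>n. X n \<in> cball t \<delta> - {t}" "X \<longlonglongrightarrow> t" for X
  proof -
    let ?q = "\<lambda>n x. (g (X n) x - g t x) / (X n - t)"
    have XI: "X n \<in> I" for n using X \<delta>(2) by auto
    have q: "set_integrable lborel D (?q n)" for n
      using int[OF XI] int[OF assms(2)] by simp
    have "(\<lambda>n. LINT x:D|lborel. ?q n x) \<longlonglongrightarrow> (LINT x:D|lborel. time_deriv g t x)"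
      unfolding set_lebesgue_integral_def
    proof (rule integral_dominated_convergence[OF _ _ intB])
      show "(\<lambda>x. indicator D x *\<^sub>R time_deriv g t x) \<in> borel_measurable lborel"
        using continuous_up_to_boundary_integrable[OF gt assms(3,4,2)]
        unfolding set_integrable_def by (rule borel_measurable_integrable)
      show "(\<lambda>x. indicator D x *\<^sub>R ?q n x) \<in> borel_measurable lborel" for n
        using q[of n] unfolding set_integrable_def by (rule borel_measurable_integrable)
      have "(\<lambda>n. ?q n x) \<longlonglongrightarrow> time_deriv g t x" if "x \<in> D" for x
        using deriv[OF assms(2) that] X
        unfolding has_field_derivative_iff tendsto_at_iff_sequentially by (auto simp: o_def)
      then show "AE x in lborel. (\<lambda>n. indicator D x *\<^sub>R ?q n x) \<longlonglongrightarrow> indicator D x *\<^sub>R time_deriv g t x"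
        by (intro AE_I2) (auto simp: indicator_def)
      show "AE x in lborel. norm (indicator D x *\<^sub>R ?q n x) \<le> B * indicator D x" for n
        using lip X by (intro AE_I2) (auto simp: indicator_def)
    qed
    moreover have "(LINT x:D|lborel. ?q n x)
        = ((LINT x:D|lborel. g (X n) x) - (LINT x:D|lborel. g t x)) / (X n - t)" for n
      using int[OF XI] int[OF assms(2)] by simp
    ultimately show ?thesis by (simp only:)
  qed
  then have "((\<lambda>s. ((LINT x:D|lborel. g s x) - (LINT x:D|lborel. g t x)) / (s - t)) \<longlongrightarrow>
      (LINT x:D|lborel. time_deriv g t x)) (at t within cball t \<delta>)"
    by (simp add: tendsto_at_iff_sequentially o_def)
  moreover have "at t within cball t \<delta> = at t"
    using \<delta>(1) by (intro at_within_interior) simp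
  ultimately show ?thesis
    by (simp add: has_field_derivative_iff)
qed

section \<open>Calculus of partial derivatives\<close>

lemma partial_deriv_eq:
  "(g has_derivative g') (at x) \<Longrightarrow> partial_deriv i g x = g' (axis i 1)"
  unfolding partial_deriv_def using frechet_derivative_at by metis

lemma has_derivative_frechet:
  "g differentiable (at x) \<Longrightarrow> (g has_derivative frechet_derivative g (at x)) (at x)"
  using frechet_derivative_works by blast

lemma partial_deriv_mult:
  fixes f g :: "real^'d::finite \<Rightarrow> real"
  assumes "f differentiable (at x)" "g differentiable (at x)"
  shows "partial_deriv i (\<lambda>y. f y * g y) x = f x * partial_deriv i g x + partial_deriv i f x * g x"
  using partial_deriv_eq[OF has_derivative_mult[OF assms[THEN has_derivative_frechet]]]
  by (simp add: partial_deriv_def)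

lemma partial_deriv_diff:
  assumes "f differentiable (at x)" "g differentiable (at x)"
  shows "partial_deriv i (\<lambda>y. f y - g y) x = partial_deriv i f x - partial_deriv i g x"
  using partial_deriv_eq[OF has_derivative_diff[OF assms[THEN has_derivative_frechet]]]
  by (simp add: partial_deriv_def)

lemma partial_deriv_const_mult:
  fixes g :: "real^'d::finite \<Rightarrow> real"
  assumes "g differentiable (at x)"
  shows "partial_deriv i (\<lambda>y. c * g y) x = c * partial_deriv i g x"
  using partial_deriv_eq[OF has_derivative_mult_right[OF has_derivative_frechet[OF assms]]]
  by (simp add: partial_deriv_def)

lemma has_derivative_component:
  fixes g :: "real^'d::finite \<Rightarrow> real^'d"
  assumes "g differentiable (at x)"
  shows "((\<lambda>y. g y $ j) has_derivative (\<lambda>h. frechet_derivative g (at x) h $ j)) (at x)"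
  using has_derivative_frechet[OF assms] by (rule bounded_linear.has_derivative[OF bounded_linear_vec_nth])

lemma partial_deriv_component:
  fixes g :: "real^'d::finite \<Rightarrow> real^'d"
  assumes "g differentiable (at x)"
  shows "partial_deriv i (\<lambda>y. g y $ j) x = partial_deriv i g x $ j"
  using partial_deriv_eq[OF has_derivative_component[OF assms]]
  by (simp add: partial_deriv_def)

text \<open>Derivatives depend only on values near the point. This carries derivatives from the flux
  over to a function that agrees with it on \<open>D\<close> but is continued differently to the
  boundary.\<close>

lemma partial_deriv_cong_open:
  assumes "open D" "x \<in> D" "\<And>y. y \<in> D \<Longrightarrow> f y = g y" "g differentiable (at x)"
  shows "f differentiable (at x)" "partial_deriv i f x = partial_deriv i g x"
proof -
  have "(f has_derivative frechet_derivative g (at x)) (at x)"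
    using has_derivative_transform_within_open[OF has_derivative_frechet[OF assms(4)] assms(1,2)]
      assms(3) by simp
  then show "f differentiable (at x)" "partial_deriv i f x = partial_deriv i g x"
    using partial_deriv_eq by (auto simp: differentiable_def partial_deriv_def)
qed

text \<open>The chain rule with a translation, whose derivative is the identity: derivatives of
  periodic functions are periodic.\<close>

lemma partial_deriv_shift:
  assumes "\<And>y. g (y + p) = g y" "g differentiable (at (x + p))"
  shows "partial_deriv i g (x + p) = partial_deriv i g x"
proof -
  have "((\<lambda>y. y + p) has_derivative (\<lambda>h. h)) (at x)"
    by (auto intro!: derivative_eq_intros)
  from diff_chain_at[OF this has_derivative_frechet[OF assms(2)]]
  have "(g has_derivative frechet_derivative g (at (x + p))) (at x)"
    by (simp add: o_def assms(1))
  from partial_deriv_eq[OF this] show ?thesis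
    by (simp add: partial_deriv_def)
qed

section \<open>Closure properties of continuity up to the boundary\<close>

named_theorems up_to_boundary

lemma continuous_up_to_boundary_const [up_to_boundary]:
  "continuous_up_to_boundary I D (\<lambda>_ _. c)"
  unfolding continuous_up_to_boundary_def by (intro exI[of _ "\<lambda>_. c"]) auto

lemma continuous_up_to_boundary_add [up_to_boundary]:
  assumes "continuous_up_to_boundary I D f" "continuous_up_to_boundary I D g"
  shows "continuous_up_to_boundary I D (\<lambda>t x. f t x + g t x)"
proof -
  from assms obtain F G where
    "continuous_on (I \<times> closure D) F" "\<forall>t\<in>I. \<forall>x\<in>D. F (t, x) = f t x"
    "continuous_on (I \<times> closure D) G" "\<forall>t\<in>I. \<forall>x\<in>D. G (t, x) = g t x"
    unfolding continuous_up_to_boundary_def by blast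
  then show ?thesis
    unfolding continuous_up_to_boundary_def
    by (intro exI[of _ "\<lambda>p. F p + G p"]) (auto intro!: continuous_on_add)
qed

lemma continuous_up_to_boundary_mult [up_to_boundary]:
  fixes f g :: "real \<Rightarrow> real^'d::finite \<Rightarrow> real"
  assumes "continuous_up_to_boundary I D f" "continuous_up_to_boundary I D g"
  shows "continuous_up_to_boundary I D (\<lambda>t x. f t x * g t x)"
proof -
  from assms obtain F G where
    "continuous_on (I \<times> closure D) F" "\<forall>t\<in>I. \<forall>x\<in>D. F (t, x) = f t x"
    "continuous_on (I \<times> closure D) G" "\<forall>t\<in>I. \<forall>x\<in>D. G (t, x) = g t x"
    unfolding continuous_up_to_boundary_def by blast
  then show ?thesis
    unfolding continuous_up_to_boundary_def
    by (intro exI[of _ "\<lambda>p. F p * G p"]) (auto intro!: continuous_on_mult)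
qed

lemma continuous_up_to_boundary_diff [up_to_boundary]:
  fixes f g :: "real \<Rightarrow> real^'d::finite \<Rightarrow> real"
  assumes "continuous_up_to_boundary I D f" "continuous_up_to_boundary I D g"
  shows "continuous_up_to_boundary I D (\<lambda>t x. f t x - g t x)"
  using continuous_up_to_boundary_add[OF assms(1)
      continuous_up_to_boundary_mult[OF continuous_up_to_boundary_const[of I D "-1"] assms(2)]]
  by simp

lemma continuous_up_to_boundary_component [up_to_boundary]:
  assumes "continuous_up_to_boundary I D f"
  shows "continuous_up_to_boundary I D (\<lambda>t x. f t x $ j)"
proof -
  from assms obtain F where
    "continuous_on (I \<times> closure D) F" "\<forall>t\<in>I. \<forall>x\<in>D. F (t, x) = f t x"
    unfolding continuous_up_to_boundary_def by blast
  then show ?thesis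
    unfolding continuous_up_to_boundary_def
    by (intro exI[of _ "\<lambda>p. F p $ j"]) (auto intro!: continuous_on_component)
qed

lemma continuous_up_to_boundary_cong:
  assumes "continuous_up_to_boundary I D f" "\<And>t x. t \<in> I \<Longrightarrow> x \<in> D \<Longrightarrow> g t x = f t x"
  shows "continuous_up_to_boundary I D g"
  using assms unfolding continuous_up_to_boundary_def by metis

section \<open>Restriction to a smaller domain\<close>

lemma continuous_up_to_boundary_mono:
  assumes "continuous_up_to_boundary I D' g" "D \<subseteq> D'"
  shows "continuous_up_to_boundary I D g"
proof -
  have "I \<times> closure D \<subseteq> I \<times> closure D'"
    using closure_mono[OF assms(2)] by blast
  then show ?thesis
    using assms unfolding continuous_up_to_boundary_def by (meson continuous_on_subset subsetD)
qed

lemma C1_space_mono: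
  assumes "C1_space I D' g" "D \<subseteq> D'"
  shows "C1_space I D g"
proof -
  have "I \<times> closure D \<subseteq> I \<times> closure D'"
    using closure_mono[OF assms(2)] by blast
  then show ?thesis
    using assms unfolding C1_space_def
    by (meson continuous_on_subset subsetD continuous_up_to_boundary_mono)
qed

lemma C1_time_C2_space_mono:
  assumes "C1_time_C2_space I D' g" "D \<subseteq> D'"
  shows "C1_time_C2_space I D g"
  using assms unfolding C1_time_C2_space_def
  by (meson C1_space_mono subsetD continuous_up_to_boundary_mono)

text \<open>Used to pass from a periodic solution on the whole space to the box, whose boundedness
  gives access to the integrability lemmas.\<close>

lemma one_equation_model_solution_mono:
  assumes "one_equation_model_solution \<mu> \<tau> \<nu> I D' f v q k" "D \<subseteq> D'"
  shows "one_equation_model_solution \<mu> \<tau> \<nu> I D f v q k"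
  unfolding one_equation_model_solution_def
proof (intro conjI)
  show "C1_time_C2_space I D v" "C1_space I D q" "C1_time_C2_space I D k"
    using assms C1_time_C2_space_mono C1_space_mono
    unfolding one_equation_model_solution_def by blast+
qed (use assms in \<open>auto simp: one_equation_model_solution_def\<close>)

section \<open>The balance of the mean of k\<close>

text \<open>The index stands before the time, so that fixing both leaves a function of space to
  which \<open>partial_deriv i\<close> applies.\<close>

definition energy_flux ::
    "real \<Rightarrow> real \<Rightarrow> (real \<Rightarrow> real^'d::finite \<Rightarrow> real^'d) \<Rightarrow> (real \<Rightarrow> real^'d \<Rightarrow> real) \<Rightarrow>
      'd \<Rightarrow> real \<Rightarrow> real^'d \<Rightarrow> real" where
  "energy_flux \<mu> \<tau> v k i t x =
     k t x * v t x $ i - eddy_viscosity \<mu> \<tau> k t x * partial_deriv i (k t) x"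

lemma eddy_viscosity_eq: "eddy_viscosity \<mu> \<tau> k t x = (sqrt 2 * \<mu> * \<tau>) * k t x"
  by (simp add: eddy_viscosity_def)

section \<open>Consequences of the equations for a fixed solution\<close>

context
  fixes \<mu> \<tau> \<nu> :: real and I :: "real set" and D :: "(real^'d::finite) set"
    and f v :: "real \<Rightarrow> real^'d \<Rightarrow> real^'d" and q k :: "real \<Rightarrow> real^'d \<Rightarrow> real"
  assumes sol: "one_equation_model_solution \<mu> \<tau> \<nu> I D f v q k"
begin

lemma solution_regular:
  shows "C1_time_C2_space I D v" "C1_time_C2_space I D k"
  using sol unfolding one_equation_model_solution_def by blast+

lemma solution_differentiable:
  assumes "t \<in> I" "x \<in> D"
  shows "k t differentiable (at x)" "v t differentiable (at x)"
    and "(\<lambda>y. v t y $ i) differentiable (at x)"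
    and "partial_deriv i (k t) differentiable (at x)"
    and "eddy_viscosity \<mu> \<tau> k t differentiable (at x)"
proof -
  show k: "k t differentiable (at x)" and v: "v t differentiable (at x)"
    and "partial_deriv i (k t) differentiable (at x)"
    using solution_regular assms unfolding C1_time_C2_space_def C1_space_def by blast+
  show "(\<lambda>y. v t y $ i) differentiable (at x)"
    using has_derivative_component[OF v] by (auto simp: differentiable_def)
  show "eddy_viscosity \<mu> \<tau> k t differentiable (at x)"
    unfolding eddy_viscosity_eq using k by (intro differentiable_mult) auto
qed

lemma energy_flux_differentiable:
  assumes "t \<in> I" "x \<in> D"
  shows "energy_flux \<mu> \<tau> v k i t differentiable (at x)"
  unfolding energy_flux_def using solution_differentiable[OF assms]
  by (intro differentiable_diff differentiable_mult)

text \<open>The product rule, expanded until every factor is a constant or is built from the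
  functions in \<open>solution_continuous_up_to_boundary\<close>; this gives the continuity of the
  flux derivative up to the boundary.\<close>

lemma partial_deriv_energy_flux:
  assumes "t \<in> I" "x \<in> D"
  shows "partial_deriv i (energy_flux \<mu> \<tau> v k i t) x =
           k t x * partial_deriv i (v t) x $ i + partial_deriv i (k t) x * v t x $ i
           - (eddy_viscosity \<mu> \<tau> k t x * partial_deriv i (partial_deriv i (k t)) x
              + (sqrt 2 * \<mu> * \<tau>) * partial_deriv i (k t) x * partial_deriv i (k t) x)"
proof -
  note d = solution_differentiable[OF assms]
  have "partial_deriv i (eddy_viscosity \<mu> \<tau> k t) x = (sqrt 2 * \<mu> * \<tau>) * partial_deriv i (k t) x"
    unfolding eddy_viscosity_eq using d by (intro partial_deriv_const_mult)
  then show ?thesis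
    unfolding energy_flux_def using d
    by (simp add: partial_deriv_diff partial_deriv_mult partial_deriv_component differentiable_mult)
qed

text \<open>Incompressibility removes \<open>k\<close> times the divergence of \<open>v\<close> from
  the product rule, which leaves the convection term.\<close>

lemma sum_partial_deriv_energy_flux:
  assumes "t \<in> I" "x \<in> D"
  shows "(\<Sum>i\<in>UNIV. partial_deriv i (energy_flux \<mu> \<tau> v k i t) x) =
           convection (v t) (k t) x - divergence (\<lambda>y. eddy_viscosity \<mu> \<tau> k t y *\<^sub>R grad (k t) y) x"
proof -
  note d = solution_differentiable[OF assms]
  have "divergence (v t) x = 0"
    using sol assms unfolding one_equation_model_solution_def by blast
  then have div0: "(\<Sum>i\<in>UNIV. partial_deriv i (v t) x $ i) = 0"
    using d by (simp add: divergence_def partial_deriv_component)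
  \<comment> \<open>The diffusive part stays unexpanded here, being already the summand of
    \<open>divergence\<close>.\<close>
  have "partial_deriv i (energy_flux \<mu> \<tau> v k i t) x =
      k t x * partial_deriv i (v t) x $ i + v t x $ i * partial_deriv i (k t) x
      - partial_deriv i (\<lambda>y. (eddy_viscosity \<mu> \<tau> k t y *\<^sub>R grad (k t) y) $ i) x" for i
    unfolding energy_flux_def using d
    by (simp add: partial_deriv_diff partial_deriv_mult partial_deriv_component
        differentiable_mult grad_def)
  then show ?thesis
    using div0 by (simp add: convection_def divergence_def sum.distrib sum_subtractf
        flip: sum_distrib_left)
qed

lemma solution_continuous_up_to_boundary:
  shows "continuous_up_to_boundary I D k" "continuous_up_to_boundary I D v"
    and "continuous_up_to_boundary I D (\<lambda>t. partial_deriv i (k t))"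
    and "continuous_up_to_boundary I D (\<lambda>t. partial_deriv i (v t))"
    and "continuous_up_to_boundary I D (\<lambda>t. partial_deriv i (partial_deriv i (k t)))"
    and "continuous_up_to_boundary I D (time_deriv k)"
    and "continuous_up_to_boundary I D (eddy_viscosity \<mu> \<tau> k)"
proof -
  note reg = solution_regular[unfolded C1_time_C2_space_def C1_space_def]
  show k: "continuous_up_to_boundary I D k"
    using reg(2) by (intro continuous_on_imp_continuous_up_to_boundary) blast
  show "continuous_up_to_boundary I D v"
    using reg(1) by (intro continuous_on_imp_continuous_up_to_boundary) blast
  show "continuous_up_to_boundary I D (\<lambda>t. partial_deriv i (k t))"
    "continuous_up_to_boundary I D (\<lambda>t. partial_deriv i (partial_deriv i (k t)))"
    "continuous_up_to_boundary I D (time_deriv k)"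
    using reg(2) by blast+
  show "continuous_up_to_boundary I D (\<lambda>t. partial_deriv i (v t))"
    using reg(1) by blast
  show "continuous_up_to_boundary I D (eddy_viscosity \<mu> \<tau> k)"
    unfolding eddy_viscosity_eq[abs_def] by (intro up_to_boundary k)
qed

lemma energy_flux_deriv_continuous_up_to_boundary:
  "continuous_up_to_boundary I D (\<lambda>t. partial_deriv i (energy_flux \<mu> \<tau> v k i t))"
  by (rule continuous_up_to_boundary_cong[OF _ partial_deriv_energy_flux])
    (auto intro!: up_to_boundary solution_continuous_up_to_boundary)

text \<open>The \<open>k\<close>-equation integrated over \<open>D\<close> and divided by its
  measure. The boundary conditions enter through \<open>flux\<close> alone, so walls and periodic
  box share this computation.\<close>

lemma mean_k_balance:
  assumes "open I" "t \<in> I" "open D" "bounded D"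
    and flux: "\<And>i. (LINT x:D|lborel. partial_deriv i (energy_flux \<mu> \<tau> v k i t) x) = 0"
  shows "mean_k D k differentiable (at t) \<and>
    deriv (mean_k D k) t + sqrt 2 / 2 * inverse \<tau> * mean_k D k t = mean_dissipation \<mu> \<tau> D v k t"
proof -
  let ?m = "measure lborel D" and ?\<alpha> = "sqrt 2 / 2 * inverse \<tau>"
  let ?F = "\<lambda>i. partial_deriv i (energy_flux \<mu> \<tau> v k i t)"
  have "((\<lambda>s. LINT x:D|lborel. k s x) has_real_derivative (LINT x:D|lborel. time_deriv k t x)) (at t)"
  proof (rule has_real_derivative_set_integral[OF assms(1-4)])
    show "(\<lambda>s. k s x) differentiable (at s)" if "s \<in> I" "x \<in> D" for s x
      using solution_regular(2) that unfolding C1_time_C2_space_def by blast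
  qed (rule solution_continuous_up_to_boundary)+
  \<comment> \<open>No case distinction arises: for empty \<open>D\<close> the measure is 0 and all
    quotients are 0.\<close>
  from DERIV_cdivide[OF this, of ?m]
  have deriv: "(mean_k D k has_real_derivative (LINT x:D|lborel. time_deriv k t x) / ?m) (at t)"
    by (simp add: mean_k_def[abs_def] space_average_def)
  have int: "set_integrable lborel D (g t)" if "continuous_up_to_boundary I D g"
    for g :: "real \<Rightarrow> real^'d \<Rightarrow> real"
    using continuous_up_to_boundary_integrable[OF that assms(3,4,2)] .
  have F: "set_integrable lborel D (?F i)" for i
    using int[OF energy_flux_deriv_continuous_up_to_boundary] .
  note kt = int[OF solution_continuous_up_to_boundary(6)]
    and k = int[OF solution_continuous_up_to_boundary(1)]
  have sumF: "set_integrable lborel D (\<lambda>x. \<Sum>i\<in>UNIV. ?F i x)"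
      "(LINT x:D|lborel. \<Sum>i\<in>UNIV. ?F i x) = 0"
    using F flux unfolding set_integrable_def set_lebesgue_integral_def scaleR_sum_right
    by (simp_all only: Bochner_Integration.integrable_sum Bochner_Integration.integral_sum sum.neutral_const)
  \<comment> \<open>Pointwise on \<open>D\<close> the equation turns the dissipation density into a
    sum of three functions already known to be integrable.\<close>
  have "(LINT x:D|lborel. eddy_viscosity \<mu> \<tau> k t x * (norm (sym_grad (v t) x))\<^sup>2)
      = (LINT x:D|lborel. time_deriv k t x + (\<Sum>i\<in>UNIV. ?F i x) + ?\<alpha> * k t x)"
  proof (rule set_lebesgue_integral_cong)
    show "\<forall>x. x \<in> D \<longrightarrow> eddy_viscosity \<mu> \<tau> k t x * (norm (sym_grad (v t) x))\<^sup>2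
        = time_deriv k t x + (\<Sum>i\<in>UNIV. ?F i x) + ?\<alpha> * k t x"
    proof (intro allI impI)
      fix x assume "x \<in> D"
      then have "time_deriv k t x + convection (v t) (k t) x
          - divergence (\<lambda>y. eddy_viscosity \<mu> \<tau> k t y *\<^sub>R grad (k t) y) x + ?\<alpha> * k t x
          = eddy_viscosity \<mu> \<tau> k t x * (norm (sym_grad (v t) x))\<^sup>2"
        using sol assms(2) unfolding one_equation_model_solution_def by blast
      then show "eddy_viscosity \<mu> \<tau> k t x * (norm (sym_grad (v t) x))\<^sup>2
          = time_deriv k t x + (\<Sum>i\<in>UNIV. ?F i x) + ?\<alpha> * k t x"
        unfolding sum_partial_deriv_energy_flux[OF assms(2) \<open>x \<in> D\<close>] by linarith
    qed
  qed (use assms(3) in simp)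
  also have "\<dots> = (LINT x:D|lborel. time_deriv k t x) + ?\<alpha> * (LINT x:D|lborel. k t x)"
    using kt k sumF by simp
  finally have "deriv (mean_k D k) t + ?\<alpha> * mean_k D k t = mean_dissipation \<mu> \<tau> D v k t"
    unfolding DERIV_imp_deriv[OF deriv] mean_k_def mean_dissipation_def space_average_def
    by (simp add: add_divide_distrib)
  moreover have "mean_k D k differentiable (at t)"
    using deriv unfolding real_differentiable_def by blast
  ultimately show ?thesis by blast
qed

text \<open>Both terms of the flux carry the factor \<open>k\<close>, so its continuous extension to
  \<open>closure D\<close> vanishes on the frontier and all end point values are 0.\<close>

lemma energy_flux_integral_eq_0_of_boundary:
  assumes "t \<in> I" "open D" "bounded D" and k0: "\<And>p. p \<in> frontier D \<Longrightarrow> k t p = 0"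
  shows "(LINT x:D|lborel. partial_deriv i (energy_flux \<mu> \<tau> v k i t) x) = 0"
proof -
  let ?c = "sqrt 2 * \<mu> * \<tau>"
  obtain G where G: "continuous_on (I \<times> closure D) G"
      "\<And>t x. t \<in> I \<Longrightarrow> x \<in> D \<Longrightarrow> G (t, x) = partial_deriv i (k t) x"
    using solution_continuous_up_to_boundary(3)[of i] unfolding continuous_up_to_boundary_def by blast
  \<comment> \<open>On the frontier \<open>partial_deriv i (k t)\<close> need not be the limit of
    its interior values, so the continuous extension \<open>G\<close> replaces it.\<close>
  define F where "F x = k t x * v t x $ i - ?c * k t x * G (t, x)" for x
  have F_eq: "F x = energy_flux \<mu> \<tau> v k i t x" if "x \<in> D" for x
    using G(2)[OF assms(1) that] by (simp add: F_def energy_flux_def eddy_viscosity_eq)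
  note F_deriv = partial_deriv_cong_open[OF assms(2) _ F_eq energy_flux_differentiable[OF assms(1)]]
  have pd: "partial_deriv i F x = partial_deriv i (energy_flux \<mu> \<tau> v k i t) x" if "x \<in> D" for x
    using F_deriv(2) that by blast
  note cub = energy_flux_deriv_continuous_up_to_boundary[of i]
  have slice: "continuous_on (closure D) (\<lambda>x. h (t, x))"
    if "continuous_on (I \<times> closure D) h" for h :: "real \<times> (real^'d) \<Rightarrow> 'b::real_normed_vector"
    using assms(1) by (intro continuous_on_compose2[OF that] continuous_intros) auto
  have "continuous_on (I \<times> closure D) (\<lambda>(t, x). k t x)" "continuous_on (I \<times> closure D) (\<lambda>(t, x). v t x)"
    using solution_regular unfolding C1_time_C2_space_def C1_space_def by blast+
  from this[THEN slice] slice[OF G(1)]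
  have F_cont: "continuous_on (closure D) F"
    unfolding F_def by (auto intro!: continuous_intros)
  have "(LINT x:D|lborel. partial_deriv i F x) = 0"
  proof (rule integral_partial_deriv_eq_0[OF assms(2,3) F_cont])
    show "F differentiable (at x)" if "x \<in> D" for x
      using F_deriv(1) that by blast
    show "continuous_on D (partial_deriv i F)"
      using continuous_up_to_boundary_continuous_on[OF cub assms(1)] pd
      by (simp cong: continuous_on_cong)
    show "bounded (partial_deriv i F ` D)"
      using continuous_up_to_boundary_bounded[OF cub assms(3), of "{t}"] assms(1) pd
      by (auto simp: bounded_iff)
    fix x s assume s: "(s::real) > 0" and x: "x \<notin> D" "x + s *\<^sub>R axis i 1 \<notin> D"
      and between: "\<And>r. 0 < r \<Longrightarrow> r < s \<Longrightarrow> x + r *\<^sub>R axis i 1 \<in> D"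
    \<comment> \<open>The end points of the segment are limits of points of \<open>D\<close> and lie
      outside the open set \<open>D\<close>, hence on its frontier.\<close>
    have "(\<lambda>r. x + r *\<^sub>R axis i 1) ` closure {0<..<s} \<subseteq> closure D"
    proof (rule image_closure_subset)
      show "(\<lambda>r. x + r *\<^sub>R axis i 1) ` {0<..<s} \<subseteq> closure D"
        using between closure_subset[of D] by auto
    qed (auto intro!: continuous_on_add continuous_on_scaleR)
    then have *: "x + r *\<^sub>R axis i 1 \<in> closure D" if "0 \<le> r" "r \<le> s" for r
      using that s by (auto simp: image_subset_iff)
    have "x \<in> frontier D" "x + s *\<^sub>R axis i 1 \<in> frontier D"
      using *[of 0] *[of s] s x assms(2) by (auto simp: frontier_def interior_open)
    then show "F x = F (x + s *\<^sub>R axis i 1)"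
      by (simp add: F_def k0)
  qed
  then show ?thesis
    using pd set_lebesgue_integral_cong[of D lborel "partial_deriv i F"] assms(2) by auto
qed

end

text \<open>The end point values cancel instead of vanishing: a maximal segment in the box parallel
  to an axis runs from one face to the opposite one, so its ends differ by a period. Smoothness on
  the whole space makes the flux continuous across the faces.\<close>

lemma energy_flux_integral_eq_0_of_periodic:
  fixes v :: "real \<Rightarrow> real^'d::finite \<Rightarrow> real^'d"
  assumes sol: "one_equation_model_solution \<mu> \<tau> \<nu> I UNIV f v q k" and t: "t \<in> I"
    and per: "box_periodic a b (v t)" "box_periodic a b (k t)"
  shows "(LINT x:box a b|lborel. partial_deriv i (energy_flux \<mu> \<tau> v k i t) x) = 0"
proof (rule integral_partial_deriv_eq_0[OF open_box bounded_box])
  note sol' = one_equation_model_solution_mono[OF sol subset_UNIV[of "box a b"]]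
  show diff: "energy_flux \<mu> \<tau> v k i t differentiable (at x)" for x
    using energy_flux_differentiable[OF sol t] by simp
  then have "continuous_on UNIV (energy_flux \<mu> \<tau> v k i t)"
    by (simp add: differentiable_imp_continuous_within continuous_at_imp_continuous_on)
  then show "continuous_on (closure (box a b)) (energy_flux \<mu> \<tau> v k i t)"
    using continuous_on_subset by blast
  note cub = energy_flux_deriv_continuous_up_to_boundary[OF sol', of i]
  show "continuous_on (box a b) (partial_deriv i (energy_flux \<mu> \<tau> v k i t))"
    using continuous_up_to_boundary_continuous_on[OF cub t] .
  show "bounded (partial_deriv i (energy_flux \<mu> \<tau> v k i t) ` box a b)"
    using continuous_up_to_boundary_bounded[OF cub bounded_box, of "{t}"] t
    by (auto simp: bounded_iff)
  fix x s assume s: "(s::real) > 0" and x: "x \<notin> box a b" "x + s *\<^sub>R axis i 1 \<notin> box a b"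
    and between: "\<And>r. 0 < r \<Longrightarrow> r < s \<Longrightarrow> x + r *\<^sub>R axis i 1 \<in> box a b"
  have i: "a $ i < x $ i + r \<and> x $ i + r < b $ i" if "0 < r" "r < s" for r
    using between[OF that] by (auto simp: mem_box_cart axis_def dest: spec[of _ i])
  \<comment> \<open>The other coordinates are constant along the segment and can be read off at its
    midpoint.\<close>
  have j: "a $ j < x $ j \<and> x $ j < b $ j" if "j \<noteq> i" for j
    using between[of "s / 2"] s that by (auto simp: mem_box_cart axis_def dest: spec[of _ j])
  have "a $ i \<le> x $ i"
  proof (rule ccontr)
    assume "\<not> a $ i \<le> x $ i"
    then obtain r where "0 < r" "r < min s (a $ i - x $ i)"
      using s dense[of 0 "min s (a $ i - x $ i)"] by auto
    then show False using i[of r] by simp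
  qed
  moreover have "x $ i + s \<le> b $ i"
  proof (rule ccontr)
    assume "\<not> x $ i + s \<le> b $ i"
    then obtain r where "max 0 (b $ i - x $ i) < r" "r < s"
      using s dense[of "max 0 (b $ i - x $ i)" s] by auto
    then show False using i[of r] by simp
  qed
  \<comment> \<open>As the other coordinates are admissible, an end point can leave the box only
    through coordinate \<open>i\<close>. With the two inequalities above, this forces
    \<open>x $ i = a $ i\<close> and \<open>x $ i + s = b $ i\<close>.\<close>
  moreover have "\<not> (a $ i < x $ i \<and> x $ i < b $ i)"
    using x(1) j unfolding mem_box_cart by metis
  moreover have "\<not> (a $ i < x $ i + s \<and> x $ i + s < b $ i)"
  proof
    assume "a $ i < x $ i + s \<and> x $ i + s < b $ i"
    then have "x + s *\<^sub>R axis i 1 \<in> box a b"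
      using j by (auto simp: mem_box_cart axis_def)
    then show False using x(2) by blast
  qed
  ultimately have "s = b $ i - a $ i" using s by linarith
  then have p: "s *\<^sub>R axis i 1 = axis i (b $ i - a $ i)"
    by (simp add: axis_def vec_eq_iff)
  have k: "k t (y + axis i (b $ i - a $ i)) = k t y"
    and v: "v t (y + axis i (b $ i - a $ i)) = v t y" for y
    using per by (auto simp: box_periodic_def)
  have "partial_deriv i (k t) (x + axis i (b $ i - a $ i)) = partial_deriv i (k t) x"
    using solution_differentiable(1)[OF sol t] by (intro partial_deriv_shift k) simp
  then show "energy_flux \<mu> \<tau> v k i t x = energy_flux \<mu> \<tau> v k i t (x + s *\<^sub>R axis i 1)"
    by (simp add: p energy_flux_def eddy_viscosity_def k v)
qed

theorem mainTheorem1: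
  fixes \<Omega> :: "(real^'d::finite) set"
    and I :: "real set"
    and \<mu> \<tau> \<nu> :: real
    and f v :: "real \<Rightarrow> real^'d \<Rightarrow> real^'d"
    and q k :: "real \<Rightarrow> real^'d \<Rightarrow> real"
  assumes "CARD('d) = 2 \<or> CARD('d) = 3"
    and "\<mu> > 0" and "\<tau> > 0" and "\<nu> > 0"
    and "open I" and "is_interval I"
    and "internal_flow \<mu> \<tau> \<nu> I \<Omega> f v q k \<or>
         shear_flow \<mu> \<tau> \<nu> I \<Omega> f v q k \<or>
         periodic_flow \<mu> \<tau> \<nu> I \<Omega> f v q k"
  shows "\<forall>t\<in>I.
           mean_k \<Omega> k differentiable (at t) \<and>
           deriv (mean_k \<Omega> k) t + sqrt 2 / 2 * inverse \<tau> * mean_k \<Omega> k t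
             = mean_dissipation \<mu> \<tau> \<Omega> v k t"
proof
  fix t assume t: "t \<in> I"
  \<comment> \<open>Internal and shear flow share the condition \<open>k = 0\<close> on the
    frontier, which makes the flux vanish there, so they form one case.\<close>
  consider (walls) "bounded_lipschitz_domain \<Omega>" "one_equation_model_solution \<mu> \<tau> \<nu> I \<Omega> f v q k"
      "\<And>p. p \<in> frontier \<Omega> \<Longrightarrow> k t p = 0"
    | (periodic) "periodic_flow \<mu> \<tau> \<nu> I \<Omega> f v q k"
    using assms(7) t unfolding internal_flow_def shear_flow_def by blast
  then show "mean_k \<Omega> k differentiable (at t) \<and>
      deriv (mean_k \<Omega> k) t + sqrt 2 / 2 * inverse \<tau> * mean_k \<Omega> k t
        = mean_dissipation \<mu> \<tau> \<Omega> v k t"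
  proof cases
    case walls
    then have "open \<Omega>" "bounded \<Omega>"
      by (auto simp: bounded_lipschitz_domain_def)
    then show ?thesis
      using walls(3) by (intro mean_k_balance[OF walls(2) assms(5) t]
          energy_flux_integral_eq_0_of_boundary[OF walls(2) t])
  next
    case periodic
    then obtain a b where \<Omega>: "\<Omega> = box a b"
      and per: "box_periodic a b (v t)" "box_periodic a b (k t)"
      and sol: "one_equation_model_solution \<mu> \<tau> \<nu> I UNIV f v q k"
      using t unfolding periodic_flow_def by blast
    show ?thesis
      unfolding \<Omega>
      \<comment> \<open>The balance uses the solution restricted to the box, the flux lemma the
        solution on the whole space.\<close>
      by (intro mean_k_balance[OF one_equation_model_solution_mono[OF sol subset_UNIV] assms(5) t]
          energy_flux_integral_eq_0_of_periodic[OF sol t per] open_box bounded_box)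
  qed
qed

end
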